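(* (1) Let $P:E\to B$ be a covering of finite categories and let $b$ be an object of $B$. Then $E$ has series Euler characteristic if and only if $B$ has series Euler characteristic. In this case, $$\chi_{\Sigma}(E)=\chi_{\Sigma}(P^{-1}(b))\,\chi_{\Sigma}(B),$$ where $P^{-1}(b)$ is regarded as a discrete category. (2) Let $(A,\mu_A)$ and $(B,\mu_B)$ be $\mathbb{N}$-filtered acyclic categories, let $b$ be an object of $B$, and let $P:A\to B$ be a covering whose fiber is finite and which satisfies $\mu_A(x)=\mu_B(P(x))$ for every object $x$ of $A$. Then $(A,\mu_A)$ has Euler characteristic $\chi_{\mathrm{fil}}(A,\mu_A)$ if and only if $(B,\mu_B)$ has Euler characteristic $\chi_{\mathrm{fil}}(B,\mu_B)$. In this case, $$\chi_{\mathrm{fil}}(A,\mu_A)=\chi_{\mathrm{fil}}(P^{-1}(b),\mu)\,\chi_{\mathrm{fil}}(B,\mu_B)$$ for any $\mathbb{N}$-filtration $\mu$ of the discrete category $P^{-1}(b)$.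
   Context: Coverings. A small category $C$ is connected if for any objects $x,y$ of $C$ there is a finite zig-zag of morphisms $x\to x_1\leftarrow x_2\to\cdots\leftarrow y$ in $C$. For an object $x$ of $C$, $S(x)$ denotes the set of morphisms of $C$ with source $x$, and $T(x)$ the set of morphisms of $C$ with target $x$. Let $E$ and $B$ be small categories with $B$ connected. A functor $P:E\to B$ is a covering if for every object $x$ of $E$ the restrictions $P:S(x)\to S(P(x))$ and $P:T(x)\to T(P(x))$ are bijections. For an object $b$ of $B$, the fiber is $P^{-1}(b)=\{x\in \mathrm{Ob}(E)\mid P(x)=b\}$, regarded as a discrete category (only objects and identity morphisms); its cardinality does not depend on the choice of $b$. Series Euler characteristic. A finite category has finitely many objects and morphisms. Let $C$ be a finite category with $\mathrm{Ob}(C)=\{x_1,\dots,x_n\}$, let $A_C$ be the $n\times n$ matrix whose $(i,j)$-entry is the number of morphisms from $x_i$ to $x_j$, and let $U$ be the $n\times n$ identity matrix. Consider the rational function $$f_C(t)=\frac{\mathrm{sum}(\mathrm{adj}(U-(A_C-U)t))}{\det(U-(A_C-U)t)},$$ where $\mathrm{adj}$ is the adjugate and $\mathrm{sum}$ is the sum of all matrix entries. $C$ has series Euler characteristic if $-1$ can be substituted for $t$ in the rational function $f_C(t)$ (i.e. $f_C$, in lowest terms, has no pole at $t=-1$), and then $\chi_{\Sigma}(C)=f_C(-1)$. Filtered acyclic categories. Here $\mathbb{N}$ includes $0$ and is regarded as a poset category. A small category $A$ is acyclic if every endomorphism and every isomorphism is an identity morphism; then $\mathrm{Ob}(A)$ is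 a poset with $x\le y$ iff there is a morphism $x\to y$. An $\mathbb{N}$-filtration of $A$ is a functor $\mu:A\to\mathbb{N}$ with $\mu(x)<\mu(y)$ whenever $x<y$ in $\mathrm{Ob}(A)$; the pair $(A,\mu)$ is an $\mathbb{N}$-filtered acyclic category. Let $\overline{N_n}(A)$ be the set of chains $x_0\xrightarrow{f_1}x_1\xrightarrow{f_2}\cdots\xrightarrow{f_n}x_n$ in $A$ with no $f_i$ an identity (so $\overline{N_0}(A)=\mathrm{Ob}(A)$), and let $\overline{N_n}(A)_i$ be the subset of those chains with $\mu(x_n)=i$. Suppose each $\overline{N_n}(A)_i$ is finite, and define the formal power series $$f_{\chi}(A,\mu)(t)=\sum_{i=0}^{\infty}(-1)^i\left(\sum_{n=0}^{i}(-1)^n\,\#\overline{N_n}(A)_i\right)t^i .$$ $(A,\mu)$ has Euler characteristic $\chi_{\mathrm{fil}}(A,\mu)$ if each $\overline{N_n}(A)_i$ is finite and $f_{\chi}(A,\mu)(t)$ is (the expansion of) a rational function with non-vanishing denominator at $t=-1$; then $\chi_{\mathrm{fil}}(A,\mu)$ is the value of this rational function at $t=-1$.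
   Formalization: The "if and only if" in (1) and (2) is claimed only when E (resp. A) has at least one object: the empty category covers every connected B and has Euler characteristic 0, while B may have none. "B has implies E (A) has" and the product formulas are stated without this restriction. *)

theory Defs
  imports
    "HOL-Computational_Algebra.Computational_Algebra"
    "HOL-Computational_Algebra.Field_as_Ring"
    "Jordan_Normal_Form.Determinant"
begin

section \<open>Small categories and functors\<close>

text \<open>The composite \<open>cmp C g f\<close> is ``\<open>g\<close> after \<open>f\<close>''.\<close>

record ('o, 'm) cat =
  Ob  :: "'o set"
  Mor :: "'m set"
  src :: "'m \<Rightarrow> 'o"
  tgt :: "'m \<Rightarrow> 'o"
  idm :: "'o \<Rightarrow> 'm"
  cmp :: "'m \<Rightarrow> 'm \<Rightarrow> 'm"

definition hom :: "('o, 'm) cat \<Rightarrow> 'o \<Rightarrow> 'o \<Rightarrow> 'm set" where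
  "hom C x y = {f \<in> Mor C. src C f = x \<and> tgt C f = y}"

definition category :: "('o, 'm) cat \<Rightarrow> bool" where
  "category C \<longleftrightarrow>
     (\<forall>f \<in> Mor C. src C f \<in> Ob C \<and> tgt C f \<in> Ob C) \<and>
     (\<forall>x \<in> Ob C. idm C x \<in> hom C x x) \<and>
     (\<forall>x \<in> Ob C. \<forall>y \<in> Ob C. \<forall>z \<in> Ob C. \<forall>f \<in> hom C x y. \<forall>g \<in> hom C y z.
        cmp C g f \<in> hom C x z) \<and>
     (\<forall>x \<in> Ob C. \<forall>y \<in> Ob C. \<forall>f \<in> hom C x y.
        cmp C f (idm C x) = f \<and> cmp C (idm C y) f = f) \<and>
     (\<forall>w \<in> Ob C. \<forall>x \<in> Ob C. \<forall>y \<in> Ob C. \<forall>z \<in> Ob C.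
        \<forall>f \<in> hom C w x. \<forall>g \<in> hom C x y. \<forall>h \<in> hom C y z.
        cmp C h (cmp C g f) = cmp C (cmp C h g) f)"

definition finite_category :: "('o, 'm) cat \<Rightarrow> bool" where
  "finite_category C \<longleftrightarrow> category C \<and> finite (Ob C) \<and> finite (Mor C)"

record ('o, 'm, 'p, 'n) ftor =
  omap :: "'o \<Rightarrow> 'p"
  mmap :: "'m \<Rightarrow> 'n"

definition is_functor ::
    "('o, 'm) cat \<Rightarrow> ('p, 'n) cat \<Rightarrow> ('o, 'm, 'p, 'n) ftor \<Rightarrow> bool" where
  "is_functor C D F \<longleftrightarrow>
     (\<forall>x \<in> Ob C. omap F x \<in> Ob D) \<and>
     (\<forall>x \<in> Ob C. \<forall>y \<in> Ob C. \<forall>f \<in> hom C x y. mmap F f \<in> hom D (omap F x) (omap F y)) \<and>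
     (\<forall>x \<in> Ob C. mmap F (idm C x) = idm D (omap F x)) \<and>
     (\<forall>x \<in> Ob C. \<forall>y \<in> Ob C. \<forall>z \<in> Ob C. \<forall>f \<in> hom C x y. \<forall>g \<in> hom C y z.
        mmap F (cmp C g f) = cmp D (mmap F g) (mmap F f))"

definition discrete :: "'o set \<Rightarrow> ('o, 'o) cat" where
  "discrete X = \<lparr>Ob = X, Mor = X, src = (\<lambda>x. x), tgt = (\<lambda>x. x),
                 idm = (\<lambda>x. x), cmp = (\<lambda>g f. f)\<rparr>"

text \<open>The poset \<open>(\<nat>, \<le>)\<close> as a category; the pair \<open>(i, j)\<close> is the unique morphism from
  \<open>i\<close> to \<open>j\<close>.\<close>

definition nat_cat :: "(nat, nat \<times> nat) cat" where
  "nat_cat = \<lparr>Ob = UNIV, Mor = {(i, j). i \<le> j}, src = fst, tgt = snd,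
              idm = (\<lambda>i. (i, i)), cmp = (\<lambda>g f. (fst f, snd g))\<rparr>"

lemma category_discrete: "category (discrete X)"
  by (auto simp: category_def discrete_def hom_def)

lemma category_nat_cat: "category nat_cat"
  by (auto simp: category_def nat_cat_def hom_def)


section \<open>Coverings\<close>

text \<open>One step of the relation is \<open>x \<rightarrow> w \<leftarrow> z\<close>; a zig-zag is a finite sequence of such steps.\<close>

definition connected_category :: "('o, 'm) cat \<Rightarrow> bool" where
  "connected_category C \<longleftrightarrow>
     (\<forall>x \<in> Ob C. \<forall>y \<in> Ob C.
        (x, y) \<in> {(x, z). \<exists>w \<in> Ob C. hom C x w \<noteq> {} \<and> hom C z w \<noteq> {}}\<^sup>*)"

definition mor_from :: "('o, 'm) cat \<Rightarrow> 'o \<Rightarrow> 'm set" where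
  "mor_from C x = {f \<in> Mor C. src C f = x}"

definition mor_to :: "('o, 'm) cat \<Rightarrow> 'o \<Rightarrow> 'm set" where
  "mor_to C x = {f \<in> Mor C. tgt C f = x}"

definition covering ::
    "('o, 'm) cat \<Rightarrow> ('p, 'n) cat \<Rightarrow> ('o, 'm, 'p, 'n) ftor \<Rightarrow> bool" where
  "covering E B P \<longleftrightarrow>
     category E \<and> category B \<and> connected_category B \<and> is_functor E B P \<and>
     (\<forall>x \<in> Ob E. bij_betw (mmap P) (mor_from E x) (mor_from B (omap P x)) \<and>
                  bij_betw (mmap P) (mor_to E x) (mor_to B (omap P x)))"

definition fiber :: "('o, 'm) cat \<Rightarrow> ('o, 'm, 'p, 'n) ftor \<Rightarrow> 'p \<Rightarrow> 'o set" where
  "fiber E P b = {x \<in> Ob E. omap P x = b}"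


section \<open>Rational functions\<close>

text \<open>\<open>quot_of_fract r\<close> is the pair (numerator, denominator) of \<open>r\<close> in lowest terms.\<close>

definition rat_defined_at :: "rat poly fract \<Rightarrow> rat \<Rightarrow> bool" where
  "rat_defined_at r a \<longleftrightarrow> poly (snd (quot_of_fract r)) a \<noteq> 0"

definition rat_value :: "rat poly fract \<Rightarrow> rat \<Rightarrow> rat" where
  "rat_value r a = poly (fst (quot_of_fract r)) a / poly (snd (quot_of_fract r)) a"

text \<open>The power series \<open>F\<close> is the expansion of \<open>r\<close> at \<open>0\<close>. Multiplying out avoids division of
  power series, which in the library truncates when the denominator is not a unit.\<close>

definition expansion_of :: "rat fps \<Rightarrow> rat poly fract \<Rightarrow> bool" where
  "expansion_of F r \<longleftrightarrow>
     F * fps_of_poly (snd (quot_of_fract r)) = fps_of_poly (fst (quot_of_fract r))"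


section \<open>Series Euler characteristic\<close>

text \<open>An arbitrary enumeration of the objects of a finite category; \<open>f_series\<close> does not depend
  on it, since reordering the objects conjugates the matrix by a permutation matrix.\<close>

definition obj_list :: "('o, 'm) cat \<Rightarrow> 'o list" where
  "obj_list C = (SOME xs. distinct xs \<and> set xs = Ob C)"

definition adj_matrix :: "('o, 'm) cat \<Rightarrow> rat poly mat" where
  "adj_matrix C = (let xs = obj_list C; n = length xs in
     mat n n (\<lambda>(i, j). of_nat (card (hom C (xs ! i) (xs ! j)))))"

definition sum_entries :: "'a :: comm_monoid_add mat \<Rightarrow> 'a" where
  "sum_entries M = (\<Sum>i < dim_row M. \<Sum>j < dim_col M. M $$ (i, j))"

definition series_matrix :: "('o, 'm) cat \<Rightarrow> rat poly mat" where
  "series_matrix C = (let A = adj_matrix C; U = 1\<^sub>m (dim_row A) in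
     U - [:0, 1:] \<cdot>\<^sub>m (A - U))"

definition f_series :: "('o, 'm) cat \<Rightarrow> rat poly fract" where
  "f_series C = Fract (sum_entries (adj_mat (series_matrix C))) (det (series_matrix C))"

definition has_chi_series :: "('o, 'm) cat \<Rightarrow> bool" where
  "has_chi_series C \<longleftrightarrow> finite_category C \<and> rat_defined_at (f_series C) (-1)"

definition chi_series :: "('o, 'm) cat \<Rightarrow> rat" where
  "chi_series C = rat_value (f_series C) (-1)"


section \<open>Filtered acyclic categories\<close>

definition is_iso :: "('o, 'm) cat \<Rightarrow> 'm \<Rightarrow> bool" where
  "is_iso C f \<longleftrightarrow> f \<in> Mor C \<and>
     (\<exists>g \<in> hom C (tgt C f) (src C f).
        cmp C g f = idm C (src C f) \<and> cmp C f g = idm C (tgt C f))"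

definition is_identity :: "('o, 'm) cat \<Rightarrow> 'm \<Rightarrow> bool" where
  "is_identity C f \<longleftrightarrow> (\<exists>x \<in> Ob C. f = idm C x)"

definition acyclic_category :: "('o, 'm) cat \<Rightarrow> bool" where
  "acyclic_category C \<longleftrightarrow> category C \<and>
     (\<forall>f \<in> Mor C. src C f = tgt C f \<longrightarrow> is_identity C f) \<and>
     (\<forall>f \<in> Mor C. is_iso C f \<longrightarrow> is_identity C f)"

text \<open>The strict order \<open>x < y\<close> on objects is: \<open>x \<noteq> y\<close> and there is a morphism from \<open>x\<close> to \<open>y\<close>.\<close>

definition nat_filtration ::
    "('o, 'm) cat \<Rightarrow> ('o, 'm, nat, nat \<times> nat) ftor \<Rightarrow> bool" where
  "nat_filtration A \<mu> \<longleftrightarrow> is_functor A nat_cat \<mu> \<and>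
     (\<forall>x \<in> Ob A. \<forall>y \<in> Ob A. x \<noteq> y \<and> hom A x y \<noteq> {} \<longrightarrow> omap \<mu> x < omap \<mu> y)"

definition filtered_acyclic ::
    "('o, 'm) cat \<Rightarrow> ('o, 'm, nat, nat \<times> nat) ftor \<Rightarrow> bool" where
  "filtered_acyclic A \<mu> \<longleftrightarrow> acyclic_category A \<and> nat_filtration A \<mu>"

text \<open>A chain is recorded as the list of its \<open>n + 1\<close> objects and the list of its \<open>n\<close>
  morphisms.\<close>

definition nd_chains :: "('o, 'm) cat \<Rightarrow> nat \<Rightarrow> ('o list \<times> 'm list) set" where
  "nd_chains A n = {(xs, fs). length xs = Suc n \<and> length fs = n \<and> set xs \<subseteq> Ob A \<and>
     (\<forall>k < n. fs ! k \<in> hom A (xs ! k) (xs ! Suc k) \<and> \<not> is_identity A (fs ! k))}"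

definition nd_chains_at ::
    "('o, 'm) cat \<Rightarrow> ('o, 'm, nat, nat \<times> nat) ftor \<Rightarrow> nat \<Rightarrow> nat \<Rightarrow> ('o list \<times> 'm list) set" where
  "nd_chains_at A \<mu> n i = {(xs, fs) \<in> nd_chains A n. omap \<mu> (xs ! n) = i}"

definition f_chi :: "('o, 'm) cat \<Rightarrow> ('o, 'm, nat, nat \<times> nat) ftor \<Rightarrow> rat fps" where
  "f_chi A \<mu> = Abs_fps (\<lambda>i. (-1) ^ i * (\<Sum>n\<le>i. (-1) ^ n * of_nat (card (nd_chains_at A \<mu> n i))))"

definition has_chi_fil :: "('o, 'm) cat \<Rightarrow> ('o, 'm, nat, nat \<times> nat) ftor \<Rightarrow> bool" where
  "has_chi_fil A \<mu> \<longleftrightarrow> (\<forall>n i. finite (nd_chains_at A \<mu> n i)) \<and>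
     (\<exists>r. expansion_of (f_chi A \<mu>) r \<and> rat_defined_at r (-1))"

definition chi_fil :: "('o, 'm) cat \<Rightarrow> ('o, 'm, nat, nat \<times> nat) ftor \<Rightarrow> rat" where
  "chi_fil A \<mu> = rat_value (THE r. expansion_of (f_chi A \<mu>) r) (-1)"

end

theory Submission
  imports Defs "HOL-Library.Equipollence"
begin

text \<open>
  Both formulas hold because the generating function that defines the Euler characteristic is
  itself multiplied by the number \<open>k\<close> of points of a fiber. This number is independent
  of the fiber: taking sources and taking targets are bijections from the lifts of a morphism
  \<open>a \<rightarrow> b\<close> to the fibers over \<open>a\<close> and over \<open>b\<close>, and the base is connected
  (\<open>fiber_eqpoll\<close>).

  For the series Euler characteristic, \<open>f_C(t)\<close> is the sum of the entries of the inverse of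
  \<open>M = U - (A_C - U) t\<close>, hence the sum of the coordinates of the solution \<open>w\<close> of
  \<open>M w = (1, ..., 1)\<close>. Unique lifting says that the morphisms from \<open>x\<close> into the fiber over
  \<open>a\<close> correspond to the morphisms from \<open>P x\<close> to \<open>a\<close>, so the entries in row \<open>x\<close> of the
  matrix of \<open>E\<close> add up over that fiber to the entry of the matrix of \<open>B\<close> at \<open>(P x, a)\<close>.
  Therefore the solution for \<open>B\<close>, composed with \<open>P\<close>, is the solution for \<open>E\<close>, and each of
  its values is repeated \<open>k\<close> times: \<open>f_E = k f_B\<close> (\<open>f_series_covering\<close>). To stay inside
  polynomial matrices the equation is multiplied by the determinant, \<open>M v = det M (1, ..., 1)\<close>.

  For the filtered Euler characteristic, a nondegenerate chain of the base has exactly one lift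
  starting at each point over its first object, and this lift is nondegenerate. Hence the number
  of chains of every length and filtration degree is multiplied by \<open>k\<close>, and so is the power
  series (\<open>f_chi_covering\<close>).

  Finally the discrete category on a fiber has characteristic \<open>k\<close> in both senses. If \<open>k\<close> is
  nonzero, multiplication by \<open>k\<close> neither creates nor removes a pole at \<open>-1\<close>. If \<open>k = 0\<close> the
  covering category is empty and its characteristic is \<open>0\<close>; this is why only the converse
  direction of the equivalences requires an object upstairs.
\<close>

section \<open>Values and expansions of rational functions\<close>

text \<open>Any representation whose denominator does not vanish at \<open>a\<close> may be evaluated in place of the
  one in lowest terms, since the reduced denominator divides every other denominator.\<close>

lemma rat_Fract:
  assumes "poly d a \<noteq> 0"
  shows rat_defined_at_Fract: "rat_defined_at (Fract n d) a"
    and rat_value_Fract: "rat_value (Fract n d) a = poly n a / poly d a"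
proof -
  define n' d' where "n' = fst (quot_of_fract (Fract n d))"
    and "d' = snd (quot_of_fract (Fract n d))"
  have nz: "d \<noteq> 0" "d' \<noteq> 0" using assms by (auto simp: d'_def)
  have "Fract n' d' = Fract n d" by (simp add: n'_def d'_def)
  hence eq: "n' * d = n * d'" using nz by (simp add: eq_fract)
  have "coprime d' n'"
    by (simp add: n'_def d'_def coprime_commute coprime_quot_of_fract)
  moreover have "d' dvd n' * d" unfolding eq by simp
  ultimately have "d' dvd d" by (simp add: coprime_dvd_mult_right_iff)
  then have d': "poly d' a \<noteq> 0" using assms by (auto elim!: dvdE)
  then show "rat_defined_at (Fract n d) a" by (simp add: rat_defined_at_def d'_def)
  have "poly n' a * poly d a = poly n a * poly d' a" by (metis eq poly_mult)
  then show "rat_value (Fract n d) a = poly n a / poly d a"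
    using assms d' by (simp add: rat_value_def flip: n'_def d'_def) (simp add: field_simps)
qed

lemma to_fract_mult_quot:
  "to_fract p * r = Fract (p * fst (quot_of_fract r)) (snd (quot_of_fract r))"
proof -
  have "to_fract p * r = to_fract p * Fract (fst (quot_of_fract r)) (snd (quot_of_fract r))"
    by simp
  then show ?thesis by (simp only: to_fract_def mult_fract mult_1)
qed

lemma rat_scale:
  assumes "rat_defined_at r a"
  shows rat_defined_at_scale: "rat_defined_at (to_fract [:c:] * r) a"
    and rat_value_scale: "rat_value (to_fract [:c:] * r) a = c * rat_value r a"
  using assms rat_Fract[of "snd (quot_of_fract r)" a "[:c:] * fst (quot_of_fract r)"]
  by (simp_all add: to_fract_mult_quot rat_defined_at_def[of r] rat_value_def[of r])

lemma rat_defined_at_scale_iff: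
  assumes "c \<noteq> 0"
  shows "rat_defined_at (to_fract [:c:] * r) a \<longleftrightarrow> rat_defined_at r a"
proof -
  have "to_fract [:inverse c:] * (to_fract [:c:] * r) = to_fract ([:inverse c:] * [:c:]) * r"
    by (simp only: to_fract_mult mult.assoc)
  also have "[:inverse c:] * [:c:] = 1" using assms by simp
  finally have "to_fract [:inverse c:] * (to_fract [:c:] * r) = r" by (simp only: to_fract_1 mult_1)
  then show ?thesis by (metis rat_defined_at_scale)
qed

text \<open>Power series over a field form a domain containing the polynomials, so cross multiplication
  transfers the defining equation from the reduced representation to any other.\<close>

lemma expansion_of_Fract:
  assumes "d \<noteq> 0"
  shows "expansion_of F (Fract n d) \<longleftrightarrow> F * fps_of_poly d = fps_of_poly n"
proof -
  define n' d' where "n' = fst (quot_of_fract (Fract n d))"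
    and "d' = snd (quot_of_fract (Fract n d))"
  have nz: "d' \<noteq> 0" by (auto simp: d'_def)
  have "Fract n' d' = Fract n d" by (simp add: n'_def d'_def)
  hence "n' * d = n * d'" using nz assms by (simp add: eq_fract)
  hence eq: "fps_of_poly n' * fps_of_poly d = fps_of_poly n * fps_of_poly d'"
    by (simp flip: fps_of_poly_mult)
  have nz': "fps_of_poly d \<noteq> 0" "fps_of_poly d' \<noteq> 0" using assms nz by auto
  have "F * fps_of_poly d' = fps_of_poly n' \<longleftrightarrow>
      (F * fps_of_poly d') * fps_of_poly d = fps_of_poly n' * fps_of_poly d"
    using nz' by (simp only: mult_cancel_right simp_thms)
  also have "\<dots> \<longleftrightarrow> (F * fps_of_poly d) * fps_of_poly d' = fps_of_poly n * fps_of_poly d'"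
    unfolding eq by (simp only: mult_ac)
  also have "\<dots> \<longleftrightarrow> F * fps_of_poly d = fps_of_poly n"
    using nz' by (simp only: mult_cancel_right simp_thms)
  finally show ?thesis by (simp add: expansion_of_def n'_def d'_def)
qed

text \<open>This makes the rational function in the definition of \<^const>\<open>chi_fil\<close> well defined.\<close>

lemma expansion_of_unique:
  assumes "expansion_of F r" "expansion_of F s"
  shows "r = s"
proof -
  define n d where "n = fst (quot_of_fract s)" and "d = snd (quot_of_fract s)"
  define n' d' where "n' = fst (quot_of_fract r)" and "d' = snd (quot_of_fract r)"
  have s: "s = Fract n d" "d \<noteq> 0" and r: "r = Fract n' d'" "d' \<noteq> 0"
    by (simp_all add: n_def d_def n'_def d'_def)
  have "fps_of_poly (n * d') = F * fps_of_poly d * fps_of_poly d'"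
    using assms(2) s by (simp add: expansion_of_Fract fps_of_poly_mult)
  also have "\<dots> = fps_of_poly (n' * d)"
    using assms(1) r by (simp add: expansion_of_Fract fps_of_poly_mult mult_ac)
  finally show ?thesis using s r by (simp add: eq_fract fps_of_poly_eq_iff)
qed

lemma expansion_of_scale:
  assumes "expansion_of F r"
  shows "expansion_of (fps_const c * F) (to_fract [:c:] * r)"
  using assms
  by (simp add: to_fract_mult_quot expansion_of_Fract fps_of_poly_smult mult.assoc)
     (simp add: expansion_of_def)

lemma chi_fil_eqI:
  assumes "expansion_of (f_chi A \<mu>) r"
  shows "chi_fil A \<mu> = rat_value r (-1)"
  using assms expansion_of_unique unfolding chi_fil_def by (metis the_equality)


section \<open>Sums of the entries of an adjugate\<close>

lemma scalar_mat_mult_vec: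
  assumes "v \<in> carrier_vec n"
  shows "(c \<cdot>\<^sub>m 1\<^sub>m n) *\<^sub>v v = c \<cdot>\<^sub>v (v :: 'a :: comm_ring_1 vec)"
  using assms by (intro eq_vecI) auto

lemma sum_entries_vec:
  assumes "A \<in> carrier_mat n n"
  shows "(\<Sum>i<n. (A *\<^sub>v (c \<cdot>\<^sub>v vec n (\<lambda>_. 1))) $ i) = c * sum_entries (A :: 'a :: comm_ring_1 mat)"
  using assms
  by (auto simp: sum_entries_def scalar_prod_def atLeast0LessThan sum_distrib_left mult_ac
      intro!: sum.cong)

text \<open>Cramer's rule, summed over the coordinates: both sides arise by applying the adjugate to
  \<open>A v = c (1, ..., 1)\<close>. It computes the quotient in \<^const>\<open>f_series\<close> from any such vector.\<close>

lemma sum_entries_adj_mat: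
  fixes A :: "'a :: comm_ring_1 mat" and v :: "'a vec"
  assumes A: "A \<in> carrier_mat n n" and v: "v \<in> carrier_vec n"
    and w: "A *\<^sub>v v = c \<cdot>\<^sub>v vec n (\<lambda>_. 1)"
  shows "det A * (\<Sum>i<n. v $ i) = c * sum_entries (adj_mat A)"
proof -
  have "adj_mat A *\<^sub>v (c \<cdot>\<^sub>v vec n (\<lambda>_. 1)) = (adj_mat A * A) *\<^sub>v v"
    unfolding w[symmetric] by (rule assoc_mult_mat_vec[symmetric, OF adj_mat(1)[OF A] A v])
  also have "\<dots> = det A \<cdot>\<^sub>v v"
    using v by (simp add: adj_mat(3)[OF A] scalar_mat_mult_vec)
  finally have "c * sum_entries (adj_mat A) = (\<Sum>i<n. (det A \<cdot>\<^sub>v v) $ i)"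
    using sum_entries_vec[OF adj_mat(1)[OF A], of c] by simp
  then show ?thesis using v by (simp add: sum_distrib_left)
qed

text \<open>The row sums of the adjugate give a vector of this kind, with \<open>c\<close> the determinant.\<close>

lemma adj_mat_weighting:
  fixes A :: "'a :: comm_ring_1 mat"
  assumes A: "A \<in> carrier_mat n n"
  obtains v :: "'a vec" where "v \<in> carrier_vec n" "A *\<^sub>v v = det A \<cdot>\<^sub>v vec n (\<lambda>_. 1)"
    "(\<Sum>i<n. v $ i) = sum_entries (adj_mat A)"
proof
  let ?e = "vec n (\<lambda>_. 1) :: 'a vec"
  let ?v = "adj_mat A *\<^sub>v ?e"
  show "?v \<in> carrier_vec n" using adj_mat(1)[OF A] by simp
  have "A *\<^sub>v ?v = (A * adj_mat A) *\<^sub>v ?e"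
    by (rule assoc_mult_mat_vec[symmetric, OF A adj_mat(1)[OF A]]) simp
  then show "A *\<^sub>v ?v = det A \<cdot>\<^sub>v ?e"
    by (simp add: adj_mat(2)[OF A] scalar_mat_mult_vec)
  show "(\<Sum>i<n. ?v $ i) = sum_entries (adj_mat A)"
    using sum_entries_vec[OF adj_mat(1)[OF A], of 1] by simp
qed


section \<open>The series matrix indexed by objects\<close>

text \<open>The entries of \<^const>\<open>series_matrix\<close>, indexed by objects instead of positions in the chosen
  enumeration, so that fibers become visible in the sums.\<close>

definition series_entry :: "('o, 'm) cat \<Rightarrow> 'o \<Rightarrow> 'o \<Rightarrow> rat poly" where
  "series_entry C x y = of_bool (x = y) - [:0, 1:] * (of_nat (card (hom C x y)) - of_bool (x = y))"

lemma obj_list: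
  assumes "finite (Ob C)"
  shows "distinct (obj_list C)" "set (obj_list C) = Ob C"
proof -
  have "\<exists>xs. distinct xs \<and> set xs = Ob C" using finite_distinct_list[OF assms] by blast
  from someI_ex[OF this] show "distinct (obj_list C)" "set (obj_list C) = Ob C"
    unfolding obj_list_def by blast+
qed

lemma series_matrix_carrier:
  "series_matrix C \<in> carrier_mat (length (obj_list C)) (length (obj_list C))"
  by (auto simp: series_matrix_def adj_matrix_def Let_def intro!: carrier_matI)

lemma series_matrix_index:
  assumes "finite (Ob C)" "i < length (obj_list C)" "j < length (obj_list C)"
  shows "series_matrix C $$ (i, j) = series_entry C (obj_list C ! i) (obj_list C ! j)"
  using assms obj_list[OF assms(1)]
  by (simp add: series_matrix_def adj_matrix_def Let_def series_entry_def nth_eq_iff_index_eq)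

lemma sum_obj_list:
  assumes "finite (Ob C)"
  shows "(\<Sum>i<length (obj_list C). g (obj_list C ! i)) = (\<Sum>x\<in>Ob C. g x)"
  using sum.reindex_bij_betw[OF bij_betw_nth[OF obj_list(1)[OF assms] refl obj_list(2)[OF assms, symmetric]]]
  by blast

lemma series_matrix_mult_vec:
  assumes "finite (Ob C)" "i < length (obj_list C)"
  shows "(series_matrix C *\<^sub>v vec (length (obj_list C)) (\<lambda>j. v (obj_list C ! j))) $ i =
    (\<Sum>y\<in>Ob C. series_entry C (obj_list C ! i) y * v y)"
proof -
  let ?n = "length (obj_list C)"
  have "(series_matrix C *\<^sub>v vec ?n (\<lambda>j. v (obj_list C ! j))) $ i =
      (\<Sum>j<?n. series_entry C (obj_list C ! i) (obj_list C ! j) * v (obj_list C ! j))"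
    using series_matrix_carrier[of C] assms
    by (auto simp: scalar_prod_def atLeast0LessThan series_matrix_index intro!: sum.cong)
  also have "\<dots> = (\<Sum>y\<in>Ob C. series_entry C (obj_list C ! i) y * v y)"
    by (rule sum_obj_list[OF assms(1)])
  finally show ?thesis .
qed

text \<open>A solution \<open>v\<close> with right hand side \<open>1\<close> in place of \<open>c\<close> is, at \<open>t = -1\<close>, Leinster's notion
  of a weighting on the category; the Euler characteristic is its total weight.\<close>

lemma weighting_sum:
  assumes fin: "finite (Ob C)"
    and w: "\<And>x. x \<in> Ob C \<Longrightarrow> (\<Sum>y\<in>Ob C. series_entry C x y * v y) = c"
  shows "det (series_matrix C) * (\<Sum>x\<in>Ob C. v x) = c * sum_entries (adj_mat (series_matrix C))"
proof -
  let ?n = "length (obj_list C)"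
  let ?v = "vec ?n (\<lambda>j. v (obj_list C ! j))"
  have "series_matrix C *\<^sub>v ?v = c \<cdot>\<^sub>v vec ?n (\<lambda>_. 1)"
  proof (rule eq_vecI)
    fix i assume "i < dim_vec (c \<cdot>\<^sub>v vec ?n (\<lambda>_. 1))"
    then have i: "i < ?n" by simp
    then have "obj_list C ! i \<in> Ob C" using obj_list(2)[OF fin] nth_mem by blast
    then show "(series_matrix C *\<^sub>v ?v) $ i = (c \<cdot>\<^sub>v vec ?n (\<lambda>_. 1)) $ i"
      unfolding series_matrix_mult_vec[OF fin i] using i by (simp add: w)
  qed (use series_matrix_carrier[of C] in simp)
  from sum_entries_adj_mat[OF series_matrix_carrier _ this]
  show ?thesis by (simp add: sum_obj_list[OF fin])
qed

lemma weighting_exists: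
  assumes fin: "finite (Ob C)"
  obtains v where "\<And>x. x \<in> Ob C \<Longrightarrow> (\<Sum>y\<in>Ob C. series_entry C x y * v y) = det (series_matrix C)"
    "(\<Sum>x\<in>Ob C. v x) = sum_entries (adj_mat (series_matrix C))"
proof -
  let ?n = "length (obj_list C)"
  obtain u :: "rat poly vec" where u: "u \<in> carrier_vec ?n"
    "series_matrix C *\<^sub>v u = det (series_matrix C) \<cdot>\<^sub>v vec ?n (\<lambda>_. 1)"
    "(\<Sum>i<?n. u $ i) = sum_entries (adj_mat (series_matrix C))"
    using adj_mat_weighting[OF series_matrix_carrier] by metis
  have inj: "inj_on ((!) (obj_list C)) {..<?n}"
    using bij_betw_nth[OF obj_list(1)[OF fin] refl refl] by (simp add: bij_betw_def)
  define v where "v = (\<lambda>x. u $ the_inv_into {..<?n} ((!) (obj_list C)) x)"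
  have v: "v (obj_list C ! i) = u $ i" if "i < ?n" for i
    using the_inv_into_f_f[OF inj] that by (simp add: v_def)
  have uv: "u = vec ?n (\<lambda>j. v (obj_list C ! j))"
    using u(1) by (auto simp: v)
  show ?thesis
  proof
    show "(\<Sum>y\<in>Ob C. series_entry C x y * v y) = det (series_matrix C)" if x: "x \<in> Ob C" for x
    proof -
      from x obtain i where i: "i < ?n" "x = obj_list C ! i"
        using obj_list(2)[OF fin] by (metis in_set_conv_nth)
      have "(\<Sum>y\<in>Ob C. series_entry C x y * v y) = (series_matrix C *\<^sub>v u) $ i"
        by (subst uv) (simp only: i(2) series_matrix_mult_vec[OF fin i(1)])
      then show ?thesis using i by (simp add: u(2))
    qed
    show "(\<Sum>x\<in>Ob C. v x) = sum_entries (adj_mat (series_matrix C))"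
      unfolding u(3)[symmetric] sum_obj_list[OF fin, symmetric] by (simp add: v)
  qed
qed

text \<open>At \<open>t = 0\<close> the matrix becomes the identity.\<close>

lemma det_series_matrix_nonzero:
  assumes "finite (Ob C)"
  shows "det (series_matrix C) \<noteq> 0"
proof -
  interpret ev: comm_ring_hom "\<lambda>p :: rat poly. poly p 0" by unfold_locales auto
  have "map_mat (\<lambda>p. poly p 0) (series_matrix C) = 1\<^sub>m (length (obj_list C))"
    by (rule eq_matI) (auto simp: series_matrix_def adj_matrix_def Let_def)
  then have "poly (det (series_matrix C)) 0 = 1"
    using ev.hom_det[of "series_matrix C"] by simp
  then show ?thesis by auto
qed

text \<open>A discrete category has \<open>A = U\<close>, so the constant vector \<open>1\<close> is the required solution.\<close>

lemma f_series_discrete: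
  assumes "finite X"
  shows "f_series (discrete X) = to_fract [:of_nat (card X):]"
proof -
  have Ob: "Ob (discrete X) = X" by (simp add: discrete_def)
  have fin: "finite (Ob (discrete X))" using assms by (simp add: Ob)
  have hom: "hom (discrete X) x y = (if x = y then {x} else {})" if "x \<in> X" for x y
    using that by (auto simp: hom_def discrete_def)
  have "series_entry (discrete X) x y = of_bool (x = y)" if "x \<in> X" for x y
    using that by (simp add: series_entry_def hom)
  then have "det (series_matrix (discrete X)) * (\<Sum>x\<in>Ob (discrete X). 1) =
      1 * sum_entries (adj_mat (series_matrix (discrete X)))"
    by (intro weighting_sum[OF fin]) (use assms in \<open>simp add: Ob of_bool_def\<close>)
  then show ?thesis
    using det_series_matrix_nonzero[OF fin]
    by (simp add: Ob f_series_def to_fract_def eq_fract of_nat_poly mult.commute)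
qed


section \<open>Lifting along a covering\<close>

lemma hom_src_tgt:
  assumes "category C" "f \<in> Mor C"
  shows "f \<in> hom C (src C f) (tgt C f)" "src C f \<in> Ob C" "tgt C f \<in> Ob C"
  using assms by (auto simp: category_def hom_def)

lemma covering_src_tgt:
  assumes "covering E B P" "f \<in> Mor E"
  shows "mmap P f \<in> Mor B" "src B (mmap P f) = omap P (src E f)"
    "tgt B (mmap P f) = omap P (tgt E f)"
proof -
  have "mmap P f \<in> hom B (omap P (src E f)) (omap P (tgt E f))"
    using assms hom_src_tgt[of E f] unfolding covering_def is_functor_def by blast
  then show "mmap P f \<in> Mor B" "src B (mmap P f) = omap P (src E f)"
    "tgt B (mmap P f) = omap P (tgt E f)" by (auto simp: hom_def)
qed

lemma covering_lift_hom:
  assumes cov: "covering E B P" and x: "x \<in> Ob E" and g: "g \<in> hom B (omap P x) b"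
  obtains f y where "y \<in> Ob E" "f \<in> hom E x y" "omap P y = b" "mmap P f = g"
proof -
  have "g \<in> mor_from B (omap P x)" using g by (simp add: hom_def mor_from_def)
  moreover have "mmap P ` mor_from E x = mor_from B (omap P x)"
    using cov x unfolding covering_def by (meson bij_betw_imp_surj_on)
  ultimately have "g \<in> mmap P ` mor_from E x" by simp
  then obtain f where f: "f \<in> mor_from E x" "mmap P f = g" by blast
  then have m: "f \<in> Mor E" "src E f = x" by (auto simp: mor_from_def)
  have "category E" using cov by (simp add: covering_def)
  note st = hom_src_tgt[OF this m(1)]
  have "tgt B g = b" using g by (simp add: hom_def)
  then have "omap P (tgt E f) = b" using covering_src_tgt(3)[OF cov m(1)] f(2) by simp
  then show thesis using that[OF st(3)] st(1) m(2) f(2) by blast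
qed

lemma covering_lift_unique:
  assumes "covering E B P" "f \<in> Mor E" "f' \<in> Mor E" "src E f = src E f'" "mmap P f = mmap P f'"
  shows "f = f'"
proof -
  have "src E f' \<in> Ob E" using assms hom_src_tgt unfolding covering_def by metis
  then have "inj_on (mmap P) (mor_from E (src E f'))"
    using assms(1) by (auto simp: covering_def bij_betw_def)
  then show ?thesis using assms by (auto simp: inj_on_def mor_from_def)
qed

lemma covering_colift_unique:
  assumes "covering E B P" "f \<in> Mor E" "f' \<in> Mor E" "tgt E f = tgt E f'" "mmap P f = mmap P f'"
  shows "f = f'"
proof -
  have "tgt E f' \<in> Ob E" using assms hom_src_tgt unfolding covering_def by metis
  then have "inj_on (mmap P) (mor_to E (tgt E f'))"
    using assms(1) by (auto simp: covering_def bij_betw_def)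
  then show ?thesis using assms by (auto simp: inj_on_def mor_to_def)
qed

text \<open>An identity is lifted by an identity, and the lift with a given source is unique. So
  nondegeneracy of a chain can be checked downstairs.\<close>

lemma is_identity_lift_iff:
  assumes cov: "covering E B P" and f: "f \<in> Mor E"
  shows "is_identity B (mmap P f) \<longleftrightarrow> is_identity E f"
proof
  have E: "category E" and B: "category B" and F: "is_functor E B P"
    using cov by (auto simp: covering_def)
  note st = hom_src_tgt[OF E f]
  { assume "is_identity E f"
    then show "is_identity B (mmap P f)" using F by (auto simp: is_identity_def is_functor_def) }
  assume "is_identity B (mmap P f)"
  then obtain b where b: "b \<in> Ob B" "mmap P f = idm B b" by (auto simp: is_identity_def)
  then have "omap P (src E f) = b"
    using covering_src_tgt(2)[OF cov f] B by (auto simp: category_def hom_def)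
  then have "mmap P (idm E (src E f)) = mmap P f"
    using F st b by (auto simp: is_functor_def)
  moreover have "idm E (src E f) \<in> hom E (src E f) (src E f)"
    using E st by (auto simp: category_def)
  ultimately have "f = idm E (src E f)"
    by (intro covering_lift_unique[OF cov f]) (auto simp: hom_def)
  then show "is_identity E f" using st by (auto simp: is_identity_def)
qed

text \<open>The bijection on morphisms out of \<open>x\<close>, restricted to those with target over \<open>b\<close>. It is
  what relates the two series matrices.\<close>

lemma card_hom_covering:
  assumes cov: "covering E B P" and x: "x \<in> Ob E" and fin: "finite (Mor E)" "finite (Ob E)"
  shows "(\<Sum>y\<in>fiber E P b. card (hom E x y)) = card (hom B (omap P x) b)"
proof -
  have "(\<Sum>y\<in>fiber E P b. card (hom E x y)) = card (\<Union>y\<in>fiber E P b. hom E x y)"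
    by (rule card_UN_disjoint[symmetric])
       (use fin in \<open>auto simp: fiber_def hom_def\<close>)
  also have "bij_betw (mmap P) (\<Union>y\<in>fiber E P b. hom E x y) (hom B (omap P x) b)"
    unfolding bij_betw_def
  proof
    show "inj_on (mmap P) (\<Union>y\<in>fiber E P b. hom E x y)"
      using covering_lift_unique[OF cov] by (fastforce simp: inj_on_def hom_def)
    show "mmap P ` (\<Union>y\<in>fiber E P b. hom E x y) = hom B (omap P x) b"
    proof
      show "mmap P ` (\<Union>y\<in>fiber E P b. hom E x y) \<subseteq> hom B (omap P x) b"
        using covering_src_tgt[OF cov] by (auto simp: hom_def fiber_def)
      show "hom B (omap P x) b \<subseteq> mmap P ` (\<Union>y\<in>fiber E P b. hom E x y)"
      proof
        fix g assume "g \<in> hom B (omap P x) b"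
        from covering_lift_hom[OF cov x this] obtain f y
          where "y \<in> Ob E" "f \<in> hom E x y" "omap P y = b" "mmap P f = g" .
        then show "g \<in> mmap P ` (\<Union>y\<in>fiber E P b. hom E x y)"
          by (force simp: fiber_def)
      qed
    qed
  qed
  then have "card (\<Union>y\<in>fiber E P b. hom E x y) = card (hom B (omap P x) b)"
    by (rule bij_betw_same_card)
  finally show ?thesis .
qed


section \<open>The size of the fibers\<close>

text \<open>The set of lifts of \<open>g\<close> is in bijection with both fibers, by source and by target; this is the
  one place where bijectivity on incoming morphisms is used.\<close>

lemma fiber_eqpoll_hom:
  assumes cov: "covering E B P" and g: "g \<in> hom B a b"
  shows "fiber E P a \<approx> fiber E P b"
proof -
  define L where "L = {f \<in> Mor E. mmap P f = g}"
  have E: "category E" using cov by (simp add: covering_def)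
  have "bij_betw (src E) L (fiber E P a)"
    unfolding bij_betw_def
  proof
    show "inj_on (src E) L" using covering_lift_unique[OF cov] by (auto simp: inj_on_def L_def)
    have "x \<in> src E ` L" if x: "x \<in> fiber E P a" for x
    proof -
      have "x \<in> Ob E" "g \<in> hom B (omap P x) b" using x g by (auto simp: fiber_def)
      from covering_lift_hom[OF cov this] obtain f y where "f \<in> hom E x y" "mmap P f = g" .
      then show ?thesis by (auto simp: L_def hom_def)
    qed
    moreover have "src E f \<in> fiber E P a" if "f \<in> L" for f
      using that covering_src_tgt(2)[OF cov, of f] hom_src_tgt(2)[OF E, of f] g
      by (simp add: L_def fiber_def hom_def)
    ultimately show "src E ` L = fiber E P a" by blast
  qed
  moreover have "bij_betw (tgt E) L (fiber E P b)"
    unfolding bij_betw_def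
  proof
    show "inj_on (tgt E) L" using covering_colift_unique[OF cov] by (auto simp: inj_on_def L_def)
    have "x \<in> tgt E ` L" if "x \<in> fiber E P b" for x
    proof -
      have "g \<in> mor_to B (omap P x)" "x \<in> Ob E"
        using that g by (auto simp: mor_to_def hom_def fiber_def)
      moreover have "mmap P ` mor_to E x = mor_to B (omap P x)"
    using cov \<open>x \<in> Ob E\<close> unfolding covering_def by (meson bij_betw_imp_surj_on)
      ultimately have "g \<in> mmap P ` mor_to E x" by simp
  then obtain f where "f \<in> mor_to E x" "mmap P f = g" by blast
      then show ?thesis by (auto simp: L_def mor_to_def)
    qed
    moreover have "tgt E f \<in> fiber E P b" if "f \<in> L" for f
      using that covering_src_tgt(3)[OF cov, of f] hom_src_tgt(3)[OF E, of f] g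
      by (simp add: L_def fiber_def hom_def)
    ultimately show "tgt E ` L = fiber E P b" by blast
  qed
  ultimately show ?thesis by (meson eqpoll_def eqpoll_sym eqpoll_trans)
qed

lemma fiber_eqpoll:
  assumes cov: "covering E B P" and "a \<in> Ob B" "b \<in> Ob B"
  shows "fiber E P a \<approx> fiber E P b"
proof -
  have "(a, b) \<in> {(x, z). \<exists>w \<in> Ob B. hom B x w \<noteq> {} \<and> hom B z w \<noteq> {}}\<^sup>*"
    using assms by (auto simp: covering_def connected_category_def)
  then show ?thesis
  proof induction
    case (step y z)
    then obtain w f g where "f \<in> hom B y w" "g \<in> hom B z w" by auto
    then have "fiber E P y \<approx> fiber E P z"
      using fiber_eqpoll_hom[OF cov] eqpoll_sym eqpoll_trans by meson
    with step.IH show ?case by (rule eqpoll_trans)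
  qed simp
qed

lemma card_fiber_eq:
  assumes "covering E B P" "a \<in> Ob B" "b \<in> Ob B"
  shows "card (fiber E P a) = card (fiber E P b)"
  using fiber_eqpoll[OF assms] by (auto simp: eqpoll_def bij_betw_same_card)

lemma finite_fiber:
  assumes "covering E B P" "a \<in> Ob B" "b \<in> Ob B" "finite (fiber E P b)"
  shows "finite (fiber E P a)"
  using fiber_eqpoll[OF assms(1-3)] assms(4) by (simp add: eqpoll_finite_iff)

lemma card_fiber_nonzero:
  assumes "covering E B P" "b \<in> Ob B" "finite (fiber E P b)" "Ob E \<noteq> {}"
  shows "card (fiber E P b) \<noteq> 0"
proof -
  obtain x where x: "x \<in> Ob E" using assms by auto
  have Px: "omap P x \<in> Ob B" using assms x by (auto simp: covering_def is_functor_def)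
  have "fiber E P (omap P x) \<noteq> {}" using x by (auto simp: fiber_def)
  then have "card (fiber E P (omap P x)) \<noteq> 0" using finite_fiber[OF assms(1) Px assms(2,3)] by simp
  then show ?thesis using card_fiber_eq[OF assms(1) Px assms(2)] by simp
qed


section \<open>The series Euler characteristic of a covering\<close>

text \<open>The solution over \<open>B\<close> is pulled back along \<open>P\<close> to a solution over \<open>E\<close>.\<close>

lemma f_series_covering:
  assumes E: "finite_category E" and B: "finite_category B" and cov: "covering E B P"
    and b: "b \<in> Ob B"
  shows "f_series E = to_fract [:of_nat (card (fiber E P b)):] * f_series B"
proof -
  let ?k = "card (fiber E P b)"
  have fin: "finite (Ob E)" "finite (Mor E)" "finite (Ob B)"
    using E B by (auto simp: finite_category_def)
  have PO: "omap P x \<in> Ob B" if "x \<in> Ob E" for x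
    using cov that by (auto simp: covering_def is_functor_def)
  have split: "(\<Sum>y\<in>Ob E. h y) = (\<Sum>a\<in>Ob B. \<Sum>y\<in>fiber E P a. h y)" for h :: "'a \<Rightarrow> rat poly"
    unfolding fiber_def by (rule sum.group[symmetric]) (use fin PO in auto)
  obtain v where v: "\<And>a. a \<in> Ob B \<Longrightarrow>
      (\<Sum>c\<in>Ob B. series_entry B a c * v c) = det (series_matrix B)"
    "(\<Sum>a\<in>Ob B. v a) = sum_entries (adj_mat (series_matrix B))"
    using weighting_exists[OF fin(3)] by metis
  have entry: "(\<Sum>y\<in>fiber E P a. series_entry E x y) = series_entry B (omap P x) a"
    if x: "x \<in> Ob E" for x a
  proof -
    have id: "(\<Sum>y\<in>fiber E P a. of_bool (x = y)) = (of_bool (omap P x = a) :: rat poly)"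
    proof -
      have "{y \<in> fiber E P a. x = y} = (if omap P x = a then {x} else {})"
        using x by (auto simp: fiber_def)
      then show ?thesis using fin x by (simp add: of_bool_def sum.If_cases Int_def fiber_def)
    qed
    have "(\<Sum>y\<in>fiber E P a. of_nat (card (hom E x y))) =
        (of_nat (card (hom B (omap P x) a)) :: rat poly)"
      unfolding card_hom_covering[OF cov x fin(2,1), symmetric] by (rule of_nat_sum[symmetric])
    then show ?thesis
      unfolding series_entry_def sum_subtractf sum_distrib_left[symmetric] id by simp
  qed
  have "det (series_matrix E) * (\<Sum>x\<in>Ob E. v (omap P x)) =
      det (series_matrix B) * sum_entries (adj_mat (series_matrix E))"
  proof (rule weighting_sum[OF fin(1)])
    fix x assume x: "x \<in> Ob E"
    have "(\<Sum>y\<in>Ob E. series_entry E x y * v (omap P y)) =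
        (\<Sum>a\<in>Ob B. \<Sum>y\<in>fiber E P a. series_entry E x y * v a)"
      unfolding split by (intro sum.cong refl) (simp add: fiber_def)
    also have "\<dots> = (\<Sum>a\<in>Ob B. series_entry B (omap P x) a * v a)"
      by (simp add: entry[OF x] flip: sum_distrib_right)
    finally show "(\<Sum>y\<in>Ob E. series_entry E x y * v (omap P y)) = det (series_matrix B)"
      using v(1)[OF PO[OF x]] by simp
  qed
  moreover have "(\<Sum>x\<in>Ob E. v (omap P x)) = (\<Sum>a\<in>Ob B. \<Sum>x\<in>fiber E P a. v a)"
    unfolding split by (intro sum.cong refl) (simp add: fiber_def)
  moreover have "\<dots> = of_nat ?k * sum_entries (adj_mat (series_matrix B))"
    by (simp add: card_fiber_eq[OF cov _ b] v(2) flip: sum_distrib_left)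
  ultimately show ?thesis
    using det_series_matrix_nonzero[OF fin(1)] det_series_matrix_nonzero[OF fin(3)]
    by (simp add: f_series_def to_fract_def eq_fract of_nat_poly mult_ac)
qed


section \<open>Lifting chains\<close>

lemma nd_chains_0: "nd_chains A 0 = {([x], []) | x. x \<in> Ob A}"
  by (auto simp: nd_chains_def length_Suc_conv)

lemma nd_chains_Cons:
  "(x # xs, f # fs) \<in> nd_chains A (Suc n) \<longleftrightarrow>
    x \<in> Ob A \<and> f \<in> hom A x (xs ! 0) \<and> \<not> is_identity A f \<and> (xs, fs) \<in> nd_chains A n"
  by (auto simp: nd_chains_def All_less_Suc2)

lemma nd_chains_SucE:
  assumes "(zs, hs) \<in> nd_chains A (Suc n)"
  obtains x xs f fs where "zs = x # xs" "hs = f # fs"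
    "x \<in> Ob A" "f \<in> hom A x (xs ! 0)" "\<not> is_identity A f" "(xs, fs) \<in> nd_chains A n"
proof -
  from assms obtain x xs f fs where z: "zs = x # xs" "hs = f # fs"
    by (auto simp: nd_chains_def length_Suc_conv)
  with assms that show thesis by (auto simp: nd_chains_Cons)
qed

lemma nd_chains_project:
  assumes cov: "covering E B P" and "(xs, fs) \<in> nd_chains E n"
  shows "(map (omap P) xs, map (mmap P) fs) \<in> nd_chains B n"
proof -
  have PO: "omap P x \<in> Ob B" if "x \<in> Ob E" for x
    using cov that by (auto simp: covering_def is_functor_def)
  have c: "length xs = Suc n" "length fs = n" "set xs \<subseteq> Ob E"
    "\<And>k. k < n \<Longrightarrow> fs ! k \<in> hom E (xs ! k) (xs ! Suc k)"
    "\<And>k. k < n \<Longrightarrow> \<not> is_identity E (fs ! k)"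
    using assms(2) by (auto simp: nd_chains_def)
  have "mmap P (fs ! k) \<in> hom B (omap P (xs ! k)) (omap P (xs ! Suc k)) \<and>
      \<not> is_identity B (mmap P (fs ! k))" if k: "k < n" for k
    using c(4,5)[OF k] is_identity_lift_iff[OF cov, of "fs ! k"] covering_src_tgt[OF cov, of "fs ! k"]
    by (simp add: hom_def)
  moreover have "set (map (omap P) xs) \<subseteq> Ob B" using c(3) PO by auto
  ultimately show ?thesis using c(1,2) by (simp add: nd_chains_def)
qed

lemma nd_chains_lift:
  assumes cov: "covering E B P"
  shows "(ys, gs) \<in> nd_chains B n \<Longrightarrow> x \<in> Ob E \<Longrightarrow> omap P x = ys ! 0 \<Longrightarrow>
    \<exists>xs fs. (xs, fs) \<in> nd_chains E n \<and> xs ! 0 = x \<and> map (omap P) xs = ys \<and> map (mmap P) fs = gs"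
proof (induction n arbitrary: x ys gs)
  case 0
  then show ?case by (intro exI[of _ "[x]"] exI[of _ "[]"]) (auto simp: nd_chains_0)
next
  case (Suc n)
  from Suc.prems(1) obtain y ys' g gs' where y: "ys = y # ys'" "gs = g # gs'"
    "g \<in> hom B y (ys' ! 0)" "\<not> is_identity B g" "(ys', gs') \<in> nd_chains B n"
    by (rule nd_chains_SucE)
  then have "g \<in> hom B (omap P x) (ys' ! 0)" using Suc.prems(3) by simp
  from covering_lift_hom[OF cov Suc.prems(2) this] obtain z f where
    z: "z \<in> Ob E" "f \<in> hom E x z" "omap P z = ys' ! 0" "mmap P f = g" .
  from Suc.IH[OF y(5) z(1,3)] obtain xs fs where
    xs: "(xs, fs) \<in> nd_chains E n" "xs ! 0 = z" "map (omap P) xs = ys'" "map (mmap P) fs = gs'"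
    by blast
  have "\<not> is_identity E f" using z y is_identity_lift_iff[OF cov, of f] by (auto simp: hom_def)
  then have "(x # xs, f # fs) \<in> nd_chains E (Suc n)"
    using z xs Suc.prems(2) by (simp add: nd_chains_Cons)
  then show ?case using xs z y Suc.prems(3) by (intro exI[of _ "x # xs"] exI[of _ "f # fs"]) auto
qed

lemma nd_chains_lift_unique:
  assumes cov: "covering E B P"
  shows "(xs, fs) \<in> nd_chains E n \<Longrightarrow> (xs', fs') \<in> nd_chains E n \<Longrightarrow> xs ! 0 = xs' ! 0 \<Longrightarrow>
    map (mmap P) fs = map (mmap P) fs' \<Longrightarrow> xs = xs' \<and> fs = fs'"
proof (induction n arbitrary: xs fs xs' fs')
  case 0
  then show ?case by (auto simp: nd_chains_0)
next
  case (Suc n)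
  from Suc.prems(1) obtain x ys f gs where y: "xs = x # ys" "fs = f # gs"
    "f \<in> hom E x (ys ! 0)" "(ys, gs) \<in> nd_chains E n"
    by (rule nd_chains_SucE)
  from Suc.prems(2) obtain x' ys' f' gs' where y': "xs' = x' # ys'" "fs' = f' # gs'"
    "f' \<in> hom E x' (ys' ! 0)" "(ys', gs') \<in> nd_chains E n"
    by (rule nd_chains_SucE)
  have "x = x'" using Suc.prems y y' by simp
  moreover have f: "f = f'"
    using Suc.prems y y' by (intro covering_lift_unique[OF cov]) (auto simp: hom_def)
  moreover have "ys ! 0 = ys' ! 0" using f y(3) y'(3) by (auto simp: hom_def)
  ultimately show ?case using Suc.IH[OF y(4) y'(4)] Suc.prems(4) y y' by simp
qed

text \<open>Unique lifting of paths: a chain upstairs amounts to its image together with its first object.\<close>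

lemma nd_chains_at_bij:
  assumes cov: "covering A B P" and mu: "\<And>x. x \<in> Ob A \<Longrightarrow> omap \<mu> x = omap \<nu> (omap P x)"
  shows "bij_betw (\<lambda>(xs, fs). ((map (omap P) xs, map (mmap P) fs), xs ! 0))
    (nd_chains_at A \<mu> n i) (SIGMA (ys, gs) : nd_chains_at B \<nu> n i. fiber A P (ys ! 0))"
    (is "bij_betw ?\<Phi> ?X ?Y")
  unfolding bij_betw_def
proof
  show "inj_on ?\<Phi> ?X"
  proof (rule inj_onI)
    fix c d assume cd: "c \<in> ?X" "d \<in> ?X" "?\<Phi> c = ?\<Phi> d"
    obtain xs fs xs' fs' where c: "c = (xs, fs)" and d: "d = (xs', fs')" by (cases c, cases d) blast
    from cd have "(xs, fs) \<in> nd_chains A n" "(xs', fs') \<in> nd_chains A n" "xs ! 0 = xs' ! 0"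
      "map (mmap P) fs = map (mmap P) fs'" unfolding c d by (simp_all add: nd_chains_at_def)
    from nd_chains_lift_unique[OF cov this] show "c = d" by (simp add: c d)
  qed
  have at: "length xs = Suc n \<and> set xs \<subseteq> Ob A" if "(xs, fs) \<in> nd_chains A n" for xs fs
    using that by (simp add: nd_chains_def)
  have nth: "xs ! j \<in> Ob A" if "(xs, fs) \<in> nd_chains A n" "j \<le> n" for xs fs j
    using at[OF that(1)] that(2) nth_mem[of j xs] by auto
  show "?\<Phi> ` ?X = ?Y"
  proof
    show "?\<Phi> ` ?X \<subseteq> ?Y"
      using nd_chains_project[OF cov] at nth mu by (auto simp: nd_chains_at_def fiber_def)
    show "?Y \<subseteq> ?\<Phi> ` ?X"
    proof
      fix p assume "p \<in> ?Y"
      then obtain ys gs x where p: "p = ((ys, gs), x)" "(ys, gs) \<in> nd_chains B n"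
        "omap \<nu> (ys ! n) = i" "x \<in> Ob A" "omap P x = ys ! 0"
        by (auto simp: nd_chains_at_def fiber_def)
      from nd_chains_lift[OF cov p(2,4,5)] obtain xs fs where
        xs: "(xs, fs) \<in> nd_chains A n" "xs ! 0 = x" "map (omap P) xs = ys" "map (mmap P) fs = gs"
        by blast
      have "omap \<mu> (xs ! n) = i" using mu nth[OF xs(1), of n] p(3) xs(3) at[OF xs(1)] by auto
      then show "p \<in> ?\<Phi> ` ?X"
        using xs p(1) by (intro image_eqI[of _ _ "(xs, fs)"]) (auto simp: nd_chains_at_def)
    qed
  qed
qed

text \<open>Finiteness upstairs implies finiteness downstairs only if no fiber is empty, as otherwise a
  chain downstairs need not lift.\<close>

lemma nd_chains_at_covering:
  assumes cov: "covering A B P" and mu: "\<And>x. x \<in> Ob A \<Longrightarrow> omap \<mu> x = omap \<nu> (omap P x)"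
    and b: "b \<in> Ob B" and fin: "finite (fiber A P b)"
  shows finite_nd_chains_at_lift: "finite (nd_chains_at B \<nu> n i) \<Longrightarrow> finite (nd_chains_at A \<mu> n i)"
    and finite_nd_chains_at_project:
      "Ob A \<noteq> {} \<Longrightarrow> finite (nd_chains_at A \<mu> n i) \<Longrightarrow> finite (nd_chains_at B \<nu> n i)"
    and card_nd_chains_at_covering: "finite (nd_chains_at B \<nu> n i) \<Longrightarrow>
      card (nd_chains_at A \<mu> n i) = card (fiber A P b) * card (nd_chains_at B \<nu> n i)"
proof -
  let ?F = "\<lambda>c. fiber A P (fst c ! 0)"
  let ?Y = "SIGMA c : nd_chains_at B \<nu> n i. ?F c"
  have bij: "\<exists>\<Phi>. bij_betw \<Phi> (nd_chains_at A \<mu> n i) ?Y"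
    using nd_chains_at_bij[OF cov mu, of n i] by (auto simp: case_prod_unfold)
  have hd: "fst c ! 0 \<in> Ob B" if "c \<in> nd_chains_at B \<nu> n i" for c
  proof -
    obtain ys gs where "c = (ys, gs)" by (cases c)
    with that show ?thesis using nth_mem[of 0 ys] by (auto simp: nd_chains_at_def nd_chains_def)
  qed
  have finF: "finite (?F c)" and cardF: "card (?F c) = card (fiber A P b)"
    if "c \<in> nd_chains_at B \<nu> n i" for c
    using finite_fiber[OF cov hd[OF that] b fin] card_fiber_eq[OF cov hd[OF that] b] by auto
  have finA: "finite (nd_chains_at A \<mu> n i) \<longleftrightarrow> finite ?Y"
    using bij bij_betw_finite by blast
  have cardA: "card (nd_chains_at A \<mu> n i) = card ?Y"
    using bij bij_betw_same_card by blast
  show "finite (nd_chains_at A \<mu> n i)" if "finite (nd_chains_at B \<nu> n i)"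
    unfolding finA using that finF by (rule finite_SigmaI)
  show "card (nd_chains_at A \<mu> n i) = card (fiber A P b) * card (nd_chains_at B \<nu> n i)"
    if "finite (nd_chains_at B \<nu> n i)"
    unfolding cardA using that finF cardF by (subst card_SigmaI) auto
  show "finite (nd_chains_at B \<nu> n i)" if A: "Ob A \<noteq> {}" "finite (nd_chains_at A \<mu> n i)"
  proof -
    have "nd_chains_at B \<nu> n i \<subseteq> fst ` ?Y"
    proof
      fix c assume c: "c \<in> nd_chains_at B \<nu> n i"
      have "card (?F c) \<noteq> 0" using cardF[OF c] card_fiber_nonzero[OF cov b fin A(1)] by simp
      then obtain x where "x \<in> ?F c" by fastforce
      with c show "c \<in> fst ` ?Y" by force
    qed
    then show ?thesis using A(2) unfolding finA by (meson finite_imageI finite_subset)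
  qed
qed


section \<open>The Euler characteristic of a covering of filtered categories\<close>

lemma f_chi_covering:
  assumes "covering A B P" "\<And>x. x \<in> Ob A \<Longrightarrow> omap \<mu> x = omap \<nu> (omap P x)"
    and "b \<in> Ob B" "finite (fiber A P b)" and fin: "\<And>n i. finite (nd_chains_at B \<nu> n i)"
  shows "f_chi A \<mu> = fps_const (of_nat (card (fiber A P b))) * f_chi B \<nu>"
  by (rule fps_ext)
     (simp add: f_chi_def card_nd_chains_at_covering[OF assms(1-4) fin] sum_distrib_left mult_ac)

lemma nd_chains_discrete:
  "nd_chains_at (discrete X) \<mu> n i =
    (if n = 0 then (\<lambda>x. ([x], [])) ` {x \<in> X. omap \<mu> x = i} else {})"
proof (cases n)
  case 0
  then show ?thesis by (auto simp: nd_chains_at_def nd_chains_0 discrete_def)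
next
  case (Suc m)
  have "is_identity (discrete X) f" if "f \<in> hom (discrete X) x y" for f x y
    using that by (auto simp: is_identity_def hom_def discrete_def)
  then have "nd_chains (discrete X) n = {}" unfolding Suc by (auto elim: nd_chains_SucE)
  then show ?thesis by (simp add: nd_chains_at_def Suc)
qed

text \<open>Only chains of length \<open>0\<close> remain, and an object of degree \<open>i\<close> contributes \<open>(-1)^i t^i\<close>, which
  equals \<open>1\<close> at \<open>t = -1\<close> whatever the filtration is.\<close>

lemma chi_fil_discrete:
  assumes "finite X"
  shows has_chi_fil_discrete: "has_chi_fil (discrete X) \<mu>"
    and chi_fil_discrete_eq: "chi_fil (discrete X) \<mu> = of_nat (card X)"
proof -
  define p :: "rat poly" where "p = (\<Sum>x\<in>X. monom ((-1) ^ omap \<mu> x) (omap \<mu> x))"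
  have card: "card (nd_chains_at (discrete X) \<mu> n i) =
      (if n = 0 then card {x \<in> X. omap \<mu> x = i} else 0)" for n i
    by (simp add: nd_chains_discrete card_image inj_on_def)
  have "f_chi (discrete X) \<mu> = fps_of_poly p"
  proof (rule fps_ext)
    fix i
    have "fps_nth (f_chi (discrete X) \<mu>) i = (-1) ^ i * of_nat (card {x \<in> X. omap \<mu> x = i})"
      by (simp add: f_chi_def card if_distrib[of of_nat] if_distrib[of "(*) _"] cong: if_cong)
    also have "\<dots> = (\<Sum>x\<in>X. if omap \<mu> x = i then (-1) ^ i else 0)"
      using assms by (simp add: sum.If_cases Int_def)
    also have "\<dots> = fps_nth (fps_of_poly p) i"
      by (auto simp: p_def coeff_sum intro!: sum.cong)
    finally show "fps_nth (f_chi (discrete X) \<mu>) i = fps_nth (fps_of_poly p) i" .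
  qed
  then have ex: "expansion_of (f_chi (discrete X) \<mu>) (Fract p 1)"
    by (simp add: expansion_of_Fract)
  moreover have "finite (nd_chains_at (discrete X) \<mu> n i)" for n i
    using assms by (simp add: nd_chains_discrete)
  ultimately show "has_chi_fil (discrete X) \<mu>"
    unfolding has_chi_fil_def using rat_defined_at_Fract[of 1 "-1" p] by auto
  have "poly p (-1) = of_nat (card X)"
    by (simp add: p_def poly_sum poly_monom flip: power_mult_distrib)
  then show "chi_fil (discrete X) \<mu> = of_nat (card X)"
    using chi_fil_eqI[OF ex] rat_value_Fract[of 1 "-1" p] by simp
qed

lemma chi_fil_covering:
  assumes hyps: "covering A B P" "\<And>x. x \<in> Ob A \<Longrightarrow> omap \<mu> x = omap \<nu> (omap P x)"
      "b \<in> Ob B" "finite (fiber A P b)"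
    and B: "has_chi_fil B \<nu>"
  shows has_chi_fil_covering: "has_chi_fil A \<mu>"
    and chi_fil_covering_eq: "chi_fil A \<mu> = of_nat (card (fiber A P b)) * chi_fil B \<nu>"
proof -
  let ?k = "of_nat (card (fiber A P b))"
  obtain r where r: "expansion_of (f_chi B \<nu>) r" "rat_defined_at r (-1)"
    and fin: "\<And>n i. finite (nd_chains_at B \<nu> n i)"
    using B by (auto simp: has_chi_fil_def)
  have "f_chi A \<mu> = fps_const ?k * f_chi B \<nu>" by (rule f_chi_covering[OF hyps fin])
  then have ex: "expansion_of (f_chi A \<mu>) (to_fract [:?k:] * r)"
    using expansion_of_scale[OF r(1)] by simp
  then show "has_chi_fil A \<mu>"
    using finite_nd_chains_at_lift[OF hyps fin] rat_defined_at_scale[OF r(2)]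
    by (auto simp: has_chi_fil_def)
  show "chi_fil A \<mu> = ?k * chi_fil B \<nu>"
    using chi_fil_eqI[OF ex] chi_fil_eqI[OF r(1)] rat_value_scale[OF r(2)] by simp
qed

text \<open>Since \<open>k\<close> is invertible, a rational function for \<open>A\<close> divided by \<open>k\<close> is one for \<open>B\<close>.\<close>

lemma has_chi_fil_base:
  assumes hyps: "covering A B P" "\<And>x. x \<in> Ob A \<Longrightarrow> omap \<mu> x = omap \<nu> (omap P x)"
      "b \<in> Ob B" "finite (fiber A P b)"
    and A: "Ob A \<noteq> {}" "has_chi_fil A \<mu>"
  shows "has_chi_fil B \<nu>"
proof -
  define k :: rat where "k = of_nat (card (fiber A P b))"
  have k: "k \<noteq> 0" using card_fiber_nonzero[OF hyps(1,3,4) A(1)] by (simp add: k_def)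
  obtain r where r: "expansion_of (f_chi A \<mu>) r" "rat_defined_at r (-1)"
    and finA: "\<And>n i. finite (nd_chains_at A \<mu> n i)"
    using A(2) by (auto simp: has_chi_fil_def)
  have fin: "finite (nd_chains_at B \<nu> n i)" for n i
    by (rule finite_nd_chains_at_project[OF hyps A(1) finA])
  have "fps_const (inverse k) * f_chi A \<mu> = f_chi B \<nu>"
    using k by (simp add: f_chi_covering[OF hyps fin] fps_const_mult flip: k_def mult.assoc)
  then have "expansion_of (f_chi B \<nu>) (to_fract [:inverse k:] * r)"
    using expansion_of_scale[OF r(1), of "inverse k"] by simp
  then show ?thesis
    using fin rat_defined_at_scale[OF r(2)] by (auto simp: has_chi_fil_def)
qed


section \<open>The two product formulas\<close>

theorem mainTheorem3:
  shows
    "(\<forall>(E :: ('o1, 'm1) cat) (B :: ('p1, 'n1) cat) P b.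
        finite_category E \<and> finite_category B \<and> covering E B P \<and> b \<in> Ob B \<longrightarrow>
        (Ob E \<noteq> {} \<longrightarrow> (has_chi_series E \<longleftrightarrow> has_chi_series B)) \<and>
        (has_chi_series B \<longrightarrow>
           has_chi_series E \<and> has_chi_series (discrete (fiber E P b)) \<and>
           chi_series E = chi_series (discrete (fiber E P b)) * chi_series B))
     \<and>
     (\<forall>(A :: ('o2, 'm2) cat) \<mu>\<^sub>A (B :: ('p2, 'n2) cat) \<mu>\<^sub>B P b.
        filtered_acyclic A \<mu>\<^sub>A \<and> filtered_acyclic B \<mu>\<^sub>B \<and> b \<in> Ob B \<and>
        covering A B P \<and> finite (fiber A P b) \<and>
        (\<forall>x \<in> Ob A. omap \<mu>\<^sub>A x = omap \<mu>\<^sub>B (omap P x)) \<longrightarrow>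
        (Ob A \<noteq> {} \<longrightarrow> (has_chi_fil A \<mu>\<^sub>A \<longleftrightarrow> has_chi_fil B \<mu>\<^sub>B)) \<and>
        (has_chi_fil B \<mu>\<^sub>B \<longrightarrow>
           has_chi_fil A \<mu>\<^sub>A \<and>
           (\<forall>\<mu>. nat_filtration (discrete (fiber A P b)) \<mu> \<longrightarrow>
              has_chi_fil (discrete (fiber A P b)) \<mu> \<and>
              chi_fil A \<mu>\<^sub>A = chi_fil (discrete (fiber A P b)) \<mu> * chi_fil B \<mu>\<^sub>B)))"
proof ((intro conjI allI impI; elim conjE), goal_cases)
  case (1 E B P b)
  have "to_fract [:of_nat (card (fiber E P b)):] * f_series B = f_series E"
    using f_series_covering 1 by metis
  moreover have "(of_nat (card (fiber E P b)) :: rat) \<noteq> 0"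
    using card_fiber_nonzero[of E B P b] 1 by (simp add: finite_category_def fiber_def)
  ultimately show ?case
    using 1 rat_defined_at_scale_iff by (metis has_chi_series_def)
next
  case (2 E B P b)
  then show ?case
    by (simp add: has_chi_series_def f_series_covering[of E B P b] rat_defined_at_scale)
next
  case (3 E B P b)
  then have "finite (fiber E P b)" by (simp add: finite_category_def fiber_def)
  then show ?case
    by (simp add: has_chi_series_def f_series_discrete finite_category_def category_discrete
        rat_defined_at_Fract to_fract_def) (simp add: discrete_def)
next
  case (4 E B P b)
  then have "finite (fiber E P b)" by (simp add: finite_category_def fiber_def)
  then have "chi_series (discrete (fiber E P b)) = of_nat (card (fiber E P b))"
    by (simp add: chi_series_def f_series_discrete rat_value_Fract to_fract_def)
  then show ?case
    using 4 by (simp add: chi_series_def has_chi_series_def f_series_covering[of E B P b] rat_value_scale)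
next
  case (5 A \<mu>\<^sub>A B \<mu>\<^sub>B P b)
  then show ?case
    using has_chi_fil_covering[of A B P \<mu>\<^sub>A \<mu>\<^sub>B b] has_chi_fil_base[of A B P \<mu>\<^sub>A \<mu>\<^sub>B b] by blast
next
  case (6 A \<mu>\<^sub>A B \<mu>\<^sub>B P b)
  then show ?case using has_chi_fil_covering[of A B P \<mu>\<^sub>A \<mu>\<^sub>B b] by blast
next
  case (7 A \<mu>\<^sub>A B \<mu>\<^sub>B P b \<mu>)
  then show ?case using has_chi_fil_discrete by blast
next
  case (8 A \<mu>\<^sub>A B \<mu>\<^sub>B P b \<mu>)
  then show ?case
    using chi_fil_covering_eq[of A B P \<mu>\<^sub>A \<mu>\<^sub>B b] chi_fil_discrete_eq[of "fiber A P b" \<mu>] by simp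
qed

end
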